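(* Let $(V_1,q_1),(V_2,q_2),(V_3,q_3)$ be finite-dimensional quadratic spaces over a field $F$ with nonsingular polar forms $b_1,b_2,b_3$ and $\dim V_1=\dim V_2=\dim V_3$. Let $*_3\colon V_1\times V_2\to V_3$ be a composition map, i.e. a bilinear map with $q_3(x_1*_3x_2)=q_1(x_1)q_2(x_2)$ for all $x_1\in V_1$, $x_2\in V_2$, and let $*_1\colon V_2\times V_3\to V_1$ and $*_2\colon V_3\times V_1\to V_2$ be its derived bilinear maps. Then $*_1$ and $*_2$ are composition maps: for all $x_i\in V_i$, $$q_1(x_2*_1x_3)=q_2(x_2)q_3(x_3),\qquad q_2(x_3*_2x_1)=q_3(x_3)q_1(x_1).$$ Moreover, for all $x_1,y_1\in V_1$, $x_2,y_2\in V_2$, $x_3,y_3\in V_3$: $$b_3(x_1*_3x_2,x_1*_3y_2)=q_1(x_1)b_2(x_2,y_2),\quad b_3(x_1*_3x_2,y_1*_3x_2)=b_1(x_1,y_1)q_2(x_2),$$ $$b_1(x_2*_1x_3,x_2*_1y_3)=q_2(x_2)b_3(x_3,y_3),\quad b_1(x_2*_1x_3,y_2*_1x_3)=b_2(x_2,y_2)q_3(x_3),$$ $$b_2(x_3*_2x_1,x_3*_2y_1)=q_3(x_3)b_1(x_1,y_1),\quad b_2(x_3*_2x_1,y_3*_2x_1)=b_3(x_3,y_3)q_1(x_1),$$ $$(x_1*_3x_2)*_2x_1=x_2q_1(x_1),\quad x_2*_1(x_1*_3x_2)=x_1q_2(x_2),$$ $$(x_2*_1x_3)*_3x_2=x_3q_2(x_2),\quad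 x_3*_2(x_2*_1x_3)=x_2q_3(x_3),$$ $$(x_3*_2x_1)*_1x_3=x_1q_3(x_3),\quad x_1*_3(x_3*_2x_1)=x_3q_1(x_1),$$ $$(x_1*_3x_2)*_2y_1+(y_1*_3x_2)*_2x_1=x_2b_1(x_1,y_1),\quad x_2*_1(x_1*_3y_2)+y_2*_1(x_1*_3x_2)=x_1b_2(x_2,y_2),$$ $$(x_2*_1x_3)*_3y_2+(y_2*_1x_3)*_3x_2=x_3b_2(x_2,y_2),\quad x_3*_2(x_2*_1y_3)+y_3*_2(x_2*_1x_3)=x_2b_3(x_3,y_3),$$ $$(x_3*_2x_1)*_1y_3+(y_3*_2x_1)*_1x_3=x_1b_3(x_3,y_3),\quad x_1*_3(x_3*_2y_1)+y_1*_3(x_3*_2x_1)=x_3b_1(x_1,y_1).$$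
   Context: $F$ is a field of arbitrary characteristic. The polar form of $q_i$ is $b_i(x,y)=q_i(x+y)-q_i(x)-q_i(y)$; it is assumed to be nonsingular (nondegenerate). The derived maps $*_1\colon V_2\times V_3\to V_1$ and $*_2\colon V_3\times V_1\to V_2$ of a bilinear map $*_3\colon V_1\times V_2\to V_3$ are the bilinear maps uniquely determined by $b_1(x_1,x_2*_1x_3)=b_2(x_2,x_3*_2x_1)=b_3(x_3,x_1*_3x_2)$ for all $x_i\in V_i$. *)

theory Defs
  imports Complex_Main
begin

text \<open>
  A vector space is given by its scalar multiplication \<open>s :: 'f \<Rightarrow> 'v \<Rightarrow> 'v\<close>, as in
  \<^theory>\<open>HOL.Vector_Spaces\<close>; the scalar multiplication of the field itself is \<open>(*)\<close>.
  \<open>Vector_Spaces.linear\<close> is qualified because \<open>linear\<close> alone is the real-linear abbreviation.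
\<close>

definition bilinear_map ::
  "('f::field \<Rightarrow> 'u::ab_group_add \<Rightarrow> 'u) \<Rightarrow> ('f \<Rightarrow> 'v::ab_group_add \<Rightarrow> 'v) \<Rightarrow>
   ('f \<Rightarrow> 'w::ab_group_add \<Rightarrow> 'w) \<Rightarrow> ('u \<Rightarrow> 'v \<Rightarrow> 'w) \<Rightarrow> bool" where
  "bilinear_map s\<^sub>u s\<^sub>v s\<^sub>w m \<longleftrightarrow>
     (\<forall>x. Vector_Spaces.linear s\<^sub>v s\<^sub>w (\<lambda>y. m x y)) \<and>
     (\<forall>y. Vector_Spaces.linear s\<^sub>u s\<^sub>w (\<lambda>x. m x y))"

definition polar_form :: "('v::ab_group_add \<Rightarrow> 'f::field) \<Rightarrow> 'v \<Rightarrow> 'v \<Rightarrow> 'f" where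
  "polar_form q x y = q (x + y) - q x - q y"

locale quadratic_space = vector_space scale
  for scale :: "'f::field \<Rightarrow> 'v::ab_group_add \<Rightarrow> 'v" +
  fixes q :: "'v \<Rightarrow> 'f"
  assumes quadratic_scale: "q (scale a x) = a\<^sup>2 * q x"
    and polar_bilinear: "bilinear_map scale scale (*) (polar_form q)"

text \<open>One-sided nondegeneracy suffices: polar forms are symmetric.\<close>

definition nonsingular_form :: "('v::ab_group_add \<Rightarrow> 'v \<Rightarrow> 'f::field) \<Rightarrow> bool" where
  "nonsingular_form b \<longleftrightarrow> (\<forall>x. (\<forall>y. b x y = 0) \<longrightarrow> x = 0)"

definition composition_map ::
  "('f::field \<Rightarrow> 'u::ab_group_add \<Rightarrow> 'u) \<Rightarrow> ('u \<Rightarrow> 'f) \<Rightarrow>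
   ('f \<Rightarrow> 'v::ab_group_add \<Rightarrow> 'v) \<Rightarrow> ('v \<Rightarrow> 'f) \<Rightarrow>
   ('f \<Rightarrow> 'w::ab_group_add \<Rightarrow> 'w) \<Rightarrow> ('w \<Rightarrow> 'f) \<Rightarrow> ('u \<Rightarrow> 'v \<Rightarrow> 'w) \<Rightarrow> bool" where
  "composition_map s\<^sub>u q\<^sub>u s\<^sub>v q\<^sub>v s\<^sub>w q\<^sub>w m \<longleftrightarrow>
     bilinear_map s\<^sub>u s\<^sub>v s\<^sub>w m \<and> (\<forall>x y. q\<^sub>w (m x y) = q\<^sub>u x * q\<^sub>v y)"

text \<open>
  \<open>derived_maps \<dots> m\<^sub>3 m\<^sub>1 m\<^sub>2\<close>: the maps \<open>m\<^sub>1 : V\<^sub>2 \<times> V\<^sub>3 \<rightarrow> V\<^sub>1\<close> and \<open>m\<^sub>2 : V\<^sub>3 \<times> V\<^sub>1 \<rightarrow> V\<^sub>2\<close> are the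
  derived maps of \<open>m\<^sub>3 : V\<^sub>1 \<times> V\<^sub>2 \<rightarrow> V\<^sub>3\<close>. That exactly one such pair exists when the polar forms are
  nonsingular and the spaces finite-dimensional is shown in \<open>derived_maps_ex1\<close>.
\<close>

definition derived_maps ::
  "('f::field \<Rightarrow> 'u::ab_group_add \<Rightarrow> 'u) \<Rightarrow> ('u \<Rightarrow> 'f) \<Rightarrow>
   ('f \<Rightarrow> 'v::ab_group_add \<Rightarrow> 'v) \<Rightarrow> ('v \<Rightarrow> 'f) \<Rightarrow>
   ('f \<Rightarrow> 'w::ab_group_add \<Rightarrow> 'w) \<Rightarrow> ('w \<Rightarrow> 'f) \<Rightarrow>
   ('u \<Rightarrow> 'v \<Rightarrow> 'w) \<Rightarrow> ('v \<Rightarrow> 'w \<Rightarrow> 'u) \<Rightarrow> ('w \<Rightarrow> 'u \<Rightarrow> 'v) \<Rightarrow> bool" where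
  "derived_maps s\<^sub>1 q\<^sub>1 s\<^sub>2 q\<^sub>2 s\<^sub>3 q\<^sub>3 m\<^sub>3 m\<^sub>1 m\<^sub>2 \<longleftrightarrow>
     bilinear_map s\<^sub>2 s\<^sub>3 s\<^sub>1 m\<^sub>1 \<and> bilinear_map s\<^sub>3 s\<^sub>1 s\<^sub>2 m\<^sub>2 \<and>
     (\<forall>x\<^sub>1 x\<^sub>2 x\<^sub>3.
        polar_form q\<^sub>1 x\<^sub>1 (m\<^sub>1 x\<^sub>2 x\<^sub>3) = polar_form q\<^sub>2 x\<^sub>2 (m\<^sub>2 x\<^sub>3 x\<^sub>1) \<and>
        polar_form q\<^sub>2 x\<^sub>2 (m\<^sub>2 x\<^sub>3 x\<^sub>1) = polar_form q\<^sub>3 x\<^sub>3 (m\<^sub>3 x\<^sub>1 x\<^sub>2))"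

lemma polar_form_commute: "polar_form q x y = polar_form q y x"
  by (simp add: polar_form_def add.commute)

lemma bilinear_mapI:
  assumes "vector_space su" "vector_space sv" "vector_space sw"
    and "\<And>x y z. m (x + y) z = m x z + m y z" "\<And>x y z. m x (y + z) = m x y + m x z"
    and "\<And>a x y. m (su a x) y = sw a (m x y)" "\<And>a x y. m x (sv a y) = sw a (m x y)"
  shows "bilinear_map su sv sw m"
  using assms unfolding bilinear_map_def
  by (auto intro!: module_hom.intro module_hom_axioms.intro
      simp: module_hom_iff_linear[symmetric] module_iff_vector_space)

lemma bilinear_mapD:
  assumes "bilinear_map su sv sw m"
  shows "m (x + y) z = m x z + m y z" "m x' (y' + z') = m x' y' + m x' z'"
    "m (su a x) z = sw a (m x z)" "m x' (sv a y') = sw a (m x' y')"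
proof -
  have "module_hom sv sw (\<lambda>y. m x y)" "module_hom su sw (\<lambda>x. m x y)" for x y
    using assms by (simp_all add: bilinear_map_def module_hom_iff_linear)
  note h = module_hom.add[OF this(1)] module_hom.scale[OF this(1)]
    module_hom.add[OF this(2)] module_hom.scale[OF this(2)]
  show "m (x + y) z = m x z + m y z" "m x' (y' + z') = m x' y' + m x' z'"
    "m (su a x) z = sw a (m x z)" "m x' (sv a y') = sw a (m x' y')"
    by (fact h)+
qed

lemma bilinear_map_vector_space:
  assumes "bilinear_map su sv sw m"
  shows "vector_space su" "vector_space sv" "vector_space sw"
  using assms unfolding bilinear_map_def Vector_Spaces.linear_def by auto

context quadratic_space
begin

lemmas polar_simps = bilinear_mapD[OF polar_bilinear]

lemma nonsingular_eqI:
  assumes "nonsingular_form (polar_form q)" "\<And>z. polar_form q z x = polar_form q z y"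
  shows "x = y"
proof -
  have "polar_form q (x - y) z = 0" for z
    using polar_simps(1)[of "x - y" y z] assms(2)[of z]
    by (simp add: polar_form_commute[of q _ z])
  with assms(1) show ?thesis by (metis nonsingular_form_def right_minus_eq)
qed

lemma functional_representable:
  assumes ns: "nonsingular_form (polar_form q)"
    and fin: "finite_dimensional_vector_space scale B"
    and lin: "Vector_Spaces.linear scale (*) \<phi>"
  shows "\<exists>x. \<forall>z. polar_form q z x = \<phi> z"
proof -
  interpret finite_dimensional_vector_space scale B by (fact fin)
  let ?b = "polar_form q"
  have bl: "Vector_Spaces.linear scale (*) (\<lambda>z. ?b z x)" for x
    using polar_bilinear by (simp add: bilinear_map_def)
  have agree: "f = g" if "Vector_Spaces.linear scale (*) f" "Vector_Spaces.linear scale (*) g"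
      "\<And>b. b \<in> B \<Longrightarrow> f b = g b" for f g :: "'v \<Rightarrow> 'f"
  proof -
    have vp: "vector_space_pair scale ((*) :: 'f \<Rightarrow> 'f \<Rightarrow> 'f)"
      using that(1) by (simp add: vector_space_pair_def Vector_Spaces.linear_def)
    show ?thesis
      using vector_space_pair.linear_eq_on[OF vp that(1,2)] that(3) span_Basis by blast
  qed
  define T where "T x = (\<Sum>b\<in>B. scale (?b b x) b)" for x
  have Tlin: "Vector_Spaces.linear scale scale T"
    unfolding module_hom_iff_linear[symmetric]
    by unfold_locales
      (simp_all add: T_def polar_simps scale_left_distrib sum.distrib scale_sum_right)
  have coords: "c b = d b" if "(\<Sum>b\<in>B. scale (c b) b) = (\<Sum>b\<in>B. scale (d b) b)" "b \<in> B" for c d b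
  proof -
    have "(\<Sum>b\<in>B. scale (c b - d b) b) = 0"
      using that(1) by (simp add: scale_left_diff_distrib sum_subtractf)
    then have "c b - d b = 0"
      using independentD[OF independent_Basis finite_Basis subset_refl, of "\<lambda>b. c b - d b"] that(2)
      by blast
    then show ?thesis by simp
  qed
  have "inj T"
  proof (rule injI)
    fix x y assume "T x = T y"
    then have "?b b x = ?b b y" if "b \<in> B" for b
      using coords[of "\<lambda>b. ?b b x" "\<lambda>b. ?b b y"] that by (simp add: T_def)
    then have "(\<lambda>z. ?b z x) = (\<lambda>z. ?b z y)" by (intro agree bl)
    then show "x = y" by (intro nonsingular_eqI[OF ns]) (rule fun_cong)
  qed
  then have "surj T" using Tlin by (rule linear_inj_imp_surj[rotated])
  then obtain x where "T x = (\<Sum>b\<in>B. scale (\<phi> b) b)" by (metis surjD)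
  then have "?b b x = \<phi> b" if "b \<in> B" for b
    using coords[of "\<lambda>b. ?b b x" \<phi>] that by (simp add: T_def)
  then have "(\<lambda>z. ?b z x) = \<phi>" by (intro agree bl lin)
  then show ?thesis by metis
qed

lemma bilinear_representable:
  assumes ns: "nonsingular_form (polar_form q)"
    and fin: "finite_dimensional_vector_space scale B"
    and vs: "vector_space su" "vector_space sv"
    and t: "\<And>y z. Vector_Spaces.linear scale (*) (\<lambda>x. t x y z)"
      "\<And>x. bilinear_map su sv (*) (t x)"
  shows "\<exists>m. bilinear_map su sv scale m \<and> (\<forall>x y z. polar_form q x (m y z) = t x y z)"
proof -
  obtain m where m: "\<And>x y z. polar_form q x (m y z) = t x y z"
    using functional_representable[OF ns fin t(1)] by metis
  note td = bilinear_mapD[OF t(2)]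
  have "bilinear_map su sv scale m"
    by (rule bilinear_mapI[OF vs vector_space_axioms]; rule nonsingular_eqI[OF ns])
      (simp_all add: m polar_simps td)
  with m show ?thesis by blast
qed

end

lemma derived_maps_ex1:
  fixes s\<^sub>1 :: "'f::field \<Rightarrow> 'u::ab_group_add \<Rightarrow> 'u"
    and s\<^sub>2 :: "'f \<Rightarrow> 'v::ab_group_add \<Rightarrow> 'v"
    and s\<^sub>3 :: "'f \<Rightarrow> 'w::ab_group_add \<Rightarrow> 'w"
  assumes qs: "quadratic_space s\<^sub>1 q\<^sub>1" "quadratic_space s\<^sub>2 q\<^sub>2" "quadratic_space s\<^sub>3 q\<^sub>3"
    and fin: "finite_dimensional_vector_space s\<^sub>1 B\<^sub>1" "finite_dimensional_vector_space s\<^sub>2 B\<^sub>2"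
    and ns: "nonsingular_form (polar_form q\<^sub>1)" "nonsingular_form (polar_form q\<^sub>2)"
    and bil: "bilinear_map s\<^sub>1 s\<^sub>2 s\<^sub>3 m\<^sub>3"
  shows "\<exists>!p. derived_maps s\<^sub>1 q\<^sub>1 s\<^sub>2 q\<^sub>2 s\<^sub>3 q\<^sub>3 m\<^sub>3 (fst p) (snd p)"
proof -
  interpret Q1: quadratic_space s\<^sub>1 q\<^sub>1 by (fact qs)
  interpret Q2: quadratic_space s\<^sub>2 q\<^sub>2 by (fact qs)
  interpret Q3: quadratic_space s\<^sub>3 q\<^sub>3 by (fact qs)
  note vs = bilinear_map_vector_space[OF bil]
  note vf = bilinear_map_vector_space(3)[OF Q1.polar_bilinear]
  note d = bilinear_mapD[OF bil] Q3.polar_simps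
  let ?t = "\<lambda>x\<^sub>1 x\<^sub>2 x\<^sub>3. polar_form q\<^sub>3 x\<^sub>3 (m\<^sub>3 x\<^sub>1 x\<^sub>2)"
  have t: "bilinear_map s\<^sub>2 s\<^sub>3 (*) (?t x\<^sub>1)" "bilinear_map s\<^sub>3 s\<^sub>1 (*) (\<lambda>x\<^sub>3 x\<^sub>1. ?t x\<^sub>1 x\<^sub>2 x\<^sub>3)"
    "bilinear_map s\<^sub>1 s\<^sub>2 (*) (\<lambda>x\<^sub>1 x\<^sub>2. ?t x\<^sub>1 x\<^sub>2 x\<^sub>3)" for x\<^sub>1 x\<^sub>2 x\<^sub>3
    by (rule bilinear_mapI[OF _ _ vf]; simp add: vs d)+
  have t1: "Vector_Spaces.linear s\<^sub>1 (*) (\<lambda>x\<^sub>1. ?t x\<^sub>1 x\<^sub>2 x\<^sub>3)"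
    and t2: "Vector_Spaces.linear s\<^sub>2 (*) (\<lambda>x\<^sub>2. ?t x\<^sub>1 x\<^sub>2 x\<^sub>3)" for x\<^sub>1 x\<^sub>2 x\<^sub>3
    using t(3) by (auto simp: bilinear_map_def)
  obtain m\<^sub>1 where m1: "bilinear_map s\<^sub>2 s\<^sub>3 s\<^sub>1 m\<^sub>1"
      "\<And>x\<^sub>1 x\<^sub>2 x\<^sub>3. polar_form q\<^sub>1 x\<^sub>1 (m\<^sub>1 x\<^sub>2 x\<^sub>3) = ?t x\<^sub>1 x\<^sub>2 x\<^sub>3"
    using Q1.bilinear_representable[OF ns(1) fin(1) vs(2,3) t1 t(1)] by metis
  obtain m\<^sub>2 where m2: "bilinear_map s\<^sub>3 s\<^sub>1 s\<^sub>2 m\<^sub>2"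
      "\<And>x\<^sub>1 x\<^sub>2 x\<^sub>3. polar_form q\<^sub>2 x\<^sub>2 (m\<^sub>2 x\<^sub>3 x\<^sub>1) = ?t x\<^sub>1 x\<^sub>2 x\<^sub>3"
    using Q2.bilinear_representable[OF ns(2) fin(2) vs(3,1), of "\<lambda>x\<^sub>2 x\<^sub>3 x\<^sub>1. ?t x\<^sub>1 x\<^sub>2 x\<^sub>3"] t2 t(2)
    by metis
  show ?thesis
  proof (rule ex1I[of _ "(m\<^sub>1, m\<^sub>2)"])
    show "derived_maps s\<^sub>1 q\<^sub>1 s\<^sub>2 q\<^sub>2 s\<^sub>3 q\<^sub>3 m\<^sub>3 (fst (m\<^sub>1, m\<^sub>2)) (snd (m\<^sub>1, m\<^sub>2))"
      by (simp add: derived_maps_def m1 m2)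
  next
    fix p assume "derived_maps s\<^sub>1 q\<^sub>1 s\<^sub>2 q\<^sub>2 s\<^sub>3 q\<^sub>3 m\<^sub>3 (fst p) (snd p)"
    then have "fst p x\<^sub>2 x\<^sub>3 = m\<^sub>1 x\<^sub>2 x\<^sub>3" "snd p x\<^sub>3 x\<^sub>1 = m\<^sub>2 x\<^sub>3 x\<^sub>1" for x\<^sub>1 x\<^sub>2 x\<^sub>3
      by (auto simp: derived_maps_def m1 m2
          intro!: Q1.nonsingular_eqI[OF ns(1)] Q2.nonsingular_eqI[OF ns(2)])
    then show "p = (m\<^sub>1, m\<^sub>2)" by (auto simp: prod_eq_iff fun_eq_iff)
  qed
qed

end

theory Submission
  imports Defs
begin

text \<open>
  The cyclic symmetry of the derived maps and the flip of the two arguments reduce everything to the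
  first composition identity. Write \<open>R\<^sub>x u = u \<star>\<^sub>3 x\<close> and \<open>L\<^sub>x z = x \<star>\<^sub>1 z\<close>; these are adjoint, and
  \<open>L\<^sub>x R\<^sub>x = q\<^sub>2 x\<close>. If \<open>q\<^sub>2 x \<noteq> 0\<close>, then \<open>R\<^sub>x\<close> is bijective since the dimensions agree, and
  \<open>q\<^sub>1 (L\<^sub>x z) = q\<^sub>2 x q\<^sub>3 z\<close> follows by writing \<open>z = R\<^sub>x u\<close>. If \<open>q\<^sub>2 x = 0 \<noteq> x\<close>, pick an
  isotropic \<open>y\<close> with \<open>b\<^sub>2 x y = 1\<close> and put \<open>t = x + y\<close>, so that \<open>L\<^sub>t\<close> and \<open>R\<^sub>t\<close> are mutually inverse.
  The images of \<open>R\<^sub>x\<close> and \<open>R\<^sub>y\<close> meet only in 0, because \<open>L\<^sub>t = L\<^sub>x + L\<^sub>y\<close> kills the intersection;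
  this forces \<open>R\<^sub>x L\<^sub>x = 0\<close>. Finally \<open>R\<^sub>x v = 0\<close> implies \<open>q\<^sub>1 v = b\<^sub>3 (R\<^sub>x v) (R\<^sub>y v) = 0\<close>.
  This argument also covers small fields, where anisotropic vectors need not span.
\<close>

text \<open>The defining identity is cyclic in the three spaces, so results about
  \<open>m\<^sub>3\<close> can be transported to \<open>m\<^sub>1\<close> and
  \<open>m\<^sub>2\<close>.\<close>

lemma derived_maps_cycle:
  assumes "derived_maps s\<^sub>1 q\<^sub>1 s\<^sub>2 q\<^sub>2 s\<^sub>3 q\<^sub>3 m\<^sub>3 m\<^sub>1 m\<^sub>2" "bilinear_map s\<^sub>1 s\<^sub>2 s\<^sub>3 m\<^sub>3"
  shows "derived_maps s\<^sub>2 q\<^sub>2 s\<^sub>3 q\<^sub>3 s\<^sub>1 q\<^sub>1 m\<^sub>1 m\<^sub>2 m\<^sub>3"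
  using assms unfolding derived_maps_def by metis

lemma bilinear_map_flip: "bilinear_map su sv sw m \<Longrightarrow> bilinear_map sv su sw (\<lambda>y x. m x y)"
  by (auto simp: bilinear_map_def)

text \<open>Exchanging the first two spaces exchanges the two derived maps and reverses their
  arguments; this carries the composition identity for \<open>m\<^sub>1\<close> over to
  \<open>m\<^sub>2\<close>.\<close>

lemma derived_maps_flip:
  assumes "derived_maps s\<^sub>1 q\<^sub>1 s\<^sub>2 q\<^sub>2 s\<^sub>3 q\<^sub>3 m\<^sub>3 m\<^sub>1 m\<^sub>2"
  shows "derived_maps s\<^sub>2 q\<^sub>2 s\<^sub>1 q\<^sub>1 s\<^sub>3 q\<^sub>3 (\<lambda>x\<^sub>2 x\<^sub>1. m\<^sub>3 x\<^sub>1 x\<^sub>2) (\<lambda>x\<^sub>1 x\<^sub>3. m\<^sub>2 x\<^sub>3 x\<^sub>1) (\<lambda>x\<^sub>3 x\<^sub>2. m\<^sub>1 x\<^sub>2 x\<^sub>3)"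
  using assms by (auto simp: derived_maps_def intro: bilinear_map_flip)

lemma composition_map_flip:
  "composition_map su qu sv qv sw qw m \<Longrightarrow> composition_map sv qv su qu sw qw (\<lambda>y x. m x y)"
  by (auto simp: composition_map_def intro: bilinear_map_flip)

lemma (in quadratic_space) q_zero [simp]: "q 0 = 0"
  using quadratic_scale[of 0 0] by simp

lemma (in quadratic_space) q_add: "q (x + y) = q x + q y + polar_form q x y"
  by (simp add: polar_form_def)

lemma (in quadratic_space) isotropic_hyperbolic_partner:
  assumes ns: "nonsingular_form (polar_form q)" and "q x = 0" "x \<noteq> 0"
  obtains y where "q y = 0" "polar_form q x y = 1"
proof -
  obtain z where z: "polar_form q x z \<noteq> 0"
    using assms by (auto simp: nonsingular_form_def)
  define w where "w = scale (inverse (polar_form q x z)) z"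
  have w: "polar_form q x w = 1"
    using z by (simp add: w_def polar_simps)
  \<comment> \<open>Here \<open>q (x + x) = 4 * q x = 0\<close>. Hence adding a multiple of
    \<open>x\<close> to \<open>w\<close> preserves its pairing with \<open>x\<close>.\<close>
  have "polar_form q x x = 0"
    using quadratic_scale[of 2 x] assms(2) scale_left_distrib[of 1 1 x] by (simp add: polar_form_def)
  then have "polar_form q x (w + scale (- q w) x) = 1"
    unfolding polar_simps w by simp
  \<comment> \<open>Since \<open>q x = 0\<close> and \<open>x\<close> pairs to 1 with
    \<open>w\<close>, adding \<open>c\<close> times \<open>x\<close> changes \<open>q w\<close> to
    \<open>q w + c\<close>; take \<open>c = - q w\<close>. There is no division by 2, so
    characteristic 2 is included.\<close>
  moreover have "q (w + scale (- q w) x) = 0"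
    unfolding q_add polar_simps polar_form_commute[of q w x] w quadratic_scale
    by (simp add: assms(2))
  ultimately show thesis using that by blast
qed

locale composition_triple =
  Q1: quadratic_space s\<^sub>1 q\<^sub>1 + Q2: quadratic_space s\<^sub>2 q\<^sub>2 + Q3: quadratic_space s\<^sub>3 q\<^sub>3
  for s\<^sub>1 :: "'f::field \<Rightarrow> 'u::ab_group_add \<Rightarrow> 'u" and q\<^sub>1
    and s\<^sub>2 :: "'f \<Rightarrow> 'v::ab_group_add \<Rightarrow> 'v" and q\<^sub>2
    and s\<^sub>3 :: "'f \<Rightarrow> 'w::ab_group_add \<Rightarrow> 'w" and q\<^sub>3 +
  fixes m\<^sub>3 :: "'u \<Rightarrow> 'v \<Rightarrow> 'w" (infix \<open>\<star>\<^sub>3\<close> 70)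
    and m\<^sub>1 :: "'v \<Rightarrow> 'w \<Rightarrow> 'u" (infix \<open>\<star>\<^sub>1\<close> 70)
    and m\<^sub>2 :: "'w \<Rightarrow> 'u \<Rightarrow> 'v" (infix \<open>\<star>\<^sub>2\<close> 70)
  assumes ns1: "nonsingular_form (polar_form q\<^sub>1)" and ns2: "nonsingular_form (polar_form q\<^sub>2)"
    and comp: "composition_map s\<^sub>1 q\<^sub>1 s\<^sub>2 q\<^sub>2 s\<^sub>3 q\<^sub>3 m\<^sub>3"
    and derived: "derived_maps s\<^sub>1 q\<^sub>1 s\<^sub>2 q\<^sub>2 s\<^sub>3 q\<^sub>3 m\<^sub>3 m\<^sub>1 m\<^sub>2"
begin

abbreviation "b\<^sub>1 \<equiv> polar_form q\<^sub>1"
abbreviation "b\<^sub>2 \<equiv> polar_form q\<^sub>2"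
abbreviation "b\<^sub>3 \<equiv> polar_form q\<^sub>3"

lemma bilinear: "bilinear_map s\<^sub>1 s\<^sub>2 s\<^sub>3 m\<^sub>3" "bilinear_map s\<^sub>2 s\<^sub>3 s\<^sub>1 m\<^sub>1" "bilinear_map s\<^sub>3 s\<^sub>1 s\<^sub>2 m\<^sub>2"
  using comp derived by (auto simp: composition_map_def derived_maps_def)

lemmas m3 = bilinear_mapD[OF bilinear(1)]
lemmas m1 = bilinear_mapD[OF bilinear(2)]
lemmas m2 = bilinear_mapD[OF bilinear(3)]

lemma q_mult: "q\<^sub>3 (x\<^sub>1 \<star>\<^sub>3 x\<^sub>2) = q\<^sub>1 x\<^sub>1 * q\<^sub>2 x\<^sub>2"
  using comp by (simp add: composition_map_def)

lemma adjoint1: "b\<^sub>1 x\<^sub>1 (x\<^sub>2 \<star>\<^sub>1 x\<^sub>3) = b\<^sub>3 x\<^sub>3 (x\<^sub>1 \<star>\<^sub>3 x\<^sub>2)"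
  and adjoint2: "b\<^sub>2 x\<^sub>2 (x\<^sub>3 \<star>\<^sub>2 x\<^sub>1) = b\<^sub>3 x\<^sub>3 (x\<^sub>1 \<star>\<^sub>3 x\<^sub>2)"
  using derived by (simp_all add: derived_maps_def)

lemma polar_mult_left: "b\<^sub>3 (x\<^sub>1 \<star>\<^sub>3 x\<^sub>2) (x\<^sub>1 \<star>\<^sub>3 y\<^sub>2) = q\<^sub>1 x\<^sub>1 * b\<^sub>2 x\<^sub>2 y\<^sub>2"
  by (simp add: polar_form_def q_mult m3(2)[symmetric] right_diff_distrib)

lemma polar_mult_right: "b\<^sub>3 (x\<^sub>1 \<star>\<^sub>3 x\<^sub>2) (y\<^sub>1 \<star>\<^sub>3 x\<^sub>2) = b\<^sub>1 x\<^sub>1 y\<^sub>1 * q\<^sub>2 x\<^sub>2"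
  by (simp add: polar_form_def q_mult m3(1)[symmetric] left_diff_distrib)

lemma mult_cancel_left: "(x\<^sub>1 \<star>\<^sub>3 x\<^sub>2) \<star>\<^sub>2 x\<^sub>1 = s\<^sub>2 (q\<^sub>1 x\<^sub>1) x\<^sub>2"
  by (rule Q2.nonsingular_eqI[OF ns2])
    (simp add: adjoint2 polar_mult_left Q2.polar_simps polar_form_commute)

lemma mult_cancel_right: "x\<^sub>2 \<star>\<^sub>1 (x\<^sub>1 \<star>\<^sub>3 x\<^sub>2) = s\<^sub>1 (q\<^sub>2 x\<^sub>2) x\<^sub>1"
  by (rule Q1.nonsingular_eqI[OF ns1])
    (simp add: adjoint1 polar_mult_right Q1.polar_simps polar_form_commute mult.commute)

text \<open>Linearization: expand the quadratic identity at \<open>x\<^sub>1 + y\<^sub>1\<close> and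
  cancel the two diagonal terms.\<close>

lemma mult_cancel_left_polar:
  "(x\<^sub>1 \<star>\<^sub>3 x\<^sub>2) \<star>\<^sub>2 y\<^sub>1 + (y\<^sub>1 \<star>\<^sub>3 x\<^sub>2) \<star>\<^sub>2 x\<^sub>1 = s\<^sub>2 (b\<^sub>1 x\<^sub>1 y\<^sub>1) x\<^sub>2"
  using mult_cancel_left[of "x\<^sub>1 + y\<^sub>1" x\<^sub>2]
  by (simp add: m2 m3 mult_cancel_left Q1.q_add Q2.scale_left_distrib algebra_simps)

lemma mult_cancel_right_polar:
  "x\<^sub>2 \<star>\<^sub>1 (x\<^sub>1 \<star>\<^sub>3 y\<^sub>2) + y\<^sub>2 \<star>\<^sub>1 (x\<^sub>1 \<star>\<^sub>3 x\<^sub>2) = s\<^sub>1 (b\<^sub>2 x\<^sub>2 y\<^sub>2) x\<^sub>1"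
  using mult_cancel_right[of "x\<^sub>2 + y\<^sub>2" x\<^sub>1]
  by (simp add: m1 m3 mult_cancel_right Q2.q_add Q1.scale_left_distrib algebra_simps)

text \<open>By \<open>mult_cancel_right\<close> the map has a left inverse up to the nonzero scalar
  \<open>q\<^sub>2 x\<^sub>2\<close>, so it is injective; equal finite dimensions make it
  surjective.\<close>

lemma mult_surj:
  assumes fin: "finite_dimensional_vector_space s\<^sub>1 B\<^sub>1" "finite_dimensional_vector_space s\<^sub>3 B\<^sub>3"
    and dim: "vector_space.dim s\<^sub>1 UNIV = vector_space.dim s\<^sub>3 UNIV"
    and "q\<^sub>2 x\<^sub>2 \<noteq> 0"
  shows "surj (\<lambda>x\<^sub>1. x\<^sub>1 \<star>\<^sub>3 x\<^sub>2)"
proof -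
  interpret finite_dimensional_vector_space_pair s\<^sub>1 B\<^sub>1 s\<^sub>3 B\<^sub>3
    using fin by (simp add: finite_dimensional_vector_space_pair_def)
  have lin: "Vector_Spaces.linear s\<^sub>1 s\<^sub>3 (\<lambda>x\<^sub>1. x\<^sub>1 \<star>\<^sub>3 x\<^sub>2)"
    using bilinear(1) by (simp add: bilinear_map_def)
  have "inj (\<lambda>x\<^sub>1. x\<^sub>1 \<star>\<^sub>3 x\<^sub>2)"
    using assms(4) by (metis injI mult_cancel_right Q1.scale_cancel_left)
  with lin show ?thesis
    using linear_injective_imp_surjective dim by simp
qed

lemma q_derived:
  assumes surj: "\<And>x\<^sub>2. q\<^sub>2 x\<^sub>2 \<noteq> 0 \<Longrightarrow> surj (\<lambda>x\<^sub>1. x\<^sub>1 \<star>\<^sub>3 x\<^sub>2)"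
  shows "q\<^sub>1 (x \<star>\<^sub>1 z) = q\<^sub>2 x * q\<^sub>3 z"
proof -
  consider "q\<^sub>2 x \<noteq> 0" | "x = 0" | "q\<^sub>2 x = 0" "x \<noteq> 0" by blast
  then show ?thesis
  proof cases
    case 1
    then obtain u where "z = u \<star>\<^sub>3 x" using surj by (metis surjD)
    \<comment> \<open>Both sides equal \<open>(q\<^sub>2 x)\<^sup>2 * q\<^sub>1 u\<close>.\<close>
    then show ?thesis
      by (simp add: mult_cancel_right q_mult Q1.quadratic_scale power2_eq_square)
  next
    case 2
    then show ?thesis using m1(3)[of 0 0 z] by simp
  next
    case 3
    then obtain y where y: "q\<^sub>2 y = 0" "b\<^sub>2 x y = 1"
      using Q2.isotropic_hyperbolic_partner[OF ns2] by blast
    define t where "t = x + y"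
    have t: "q\<^sub>2 t = 1" using 3 y by (simp add: t_def Q2.q_add)
    have L_t: "t \<star>\<^sub>1 a = x \<star>\<^sub>1 a + y \<star>\<^sub>1 a" and R_t: "c \<star>\<^sub>3 t = c \<star>\<^sub>3 x + c \<star>\<^sub>3 y" for a c
      by (simp_all add: t_def m1 m3)
    have L_R: "x \<star>\<^sub>1 (c \<star>\<^sub>3 x) = 0" "y \<star>\<^sub>1 (c \<star>\<^sub>3 y) = 0" "t \<star>\<^sub>1 (c \<star>\<^sub>3 t) = c" for c
      using 3 y t by (simp_all add: mult_cancel_right)
    have R_L: "(t \<star>\<^sub>1 a) \<star>\<^sub>3 t = a" for a
      using surjD[OF surj[of t], of a] t L_R(3) by auto
    \<comment> \<open>The witness is \<open>t \<star>\<^sub>1 z\<close>.\<close>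
    obtain u where z: "z = u \<star>\<^sub>3 x + u \<star>\<^sub>3 y" using R_L R_t by metis
    \<comment> \<open>As \<open>b\<^sub>2 x y = 1\<close>, polarization gives
      \<open>L_x R_y u + L_y R_x u = u\<close>; moreover \<open>L_x z = L_x R_y u\<close> because
      \<open>L_x R_x = 0\<close>.\<close>
    have "x \<star>\<^sub>1 z + y \<star>\<^sub>1 (u \<star>\<^sub>3 x) = u"
      using mult_cancel_right_polar[of x u y] y by (simp add: z m1 L_R)
    then have "(x \<star>\<^sub>1 z) \<star>\<^sub>3 x + (y \<star>\<^sub>1 (u \<star>\<^sub>3 x)) \<star>\<^sub>3 x = u \<star>\<^sub>3 x"
      by (metis m3(1))
    \<comment> \<open>This expands \<open>R_t L_t (R_x u) = R_x u\<close>. Comparison with the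
      previous equation puts \<open>R_x L_x z\<close> in the image of \<open>R_y\<close> as
      well.\<close>
    moreover have "(y \<star>\<^sub>1 (u \<star>\<^sub>3 x)) \<star>\<^sub>3 x + (y \<star>\<^sub>1 (u \<star>\<^sub>3 x)) \<star>\<^sub>3 y = u \<star>\<^sub>3 x"
      using R_L[of "u \<star>\<^sub>3 x"] by (simp add: L_t R_t L_R)
    ultimately have w: "(x \<star>\<^sub>1 z) \<star>\<^sub>3 x = (y \<star>\<^sub>1 (u \<star>\<^sub>3 x)) \<star>\<^sub>3 y"
      by (metis add.commute add_left_imp_eq)
    have "t \<star>\<^sub>1 ((x \<star>\<^sub>1 z) \<star>\<^sub>3 x) = 0"
      \<comment> \<open>Only the argument of \<open>L_y\<close> is rewritten by \<open>w\<close>: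
        then \<open>L_x\<close> meets a value of \<open>R_x\<close> and \<open>L_y\<close> a value
        of \<open>R_y\<close>, and both terms vanish.\<close>
      unfolding L_t by (subst (2) w) (simp add: L_R)
    then have ker: "(x \<star>\<^sub>1 z) \<star>\<^sub>3 x = 0"
      using R_L[of "(x \<star>\<^sub>1 z) \<star>\<^sub>3 x"] m3(3)[of 0 0 t] by simp
    \<comment> \<open>By \<open>polar_mult_left\<close> this value is
      \<open>q\<^sub>1 (x \<star>\<^sub>1 z) * b\<^sub>2 x y\<close>, which is
      \<open>q\<^sub>1 (x \<star>\<^sub>1 z)\<close>.\<close>
    have "b\<^sub>3 ((x \<star>\<^sub>1 z) \<star>\<^sub>3 x) ((x \<star>\<^sub>1 z) \<star>\<^sub>3 y) = 0"
      unfolding ker by (simp add: polar_form_def)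
    then show ?thesis
      using 3 y by (simp add: polar_mult_left)
  qed
qed

lemma composition_derived:
  assumes "finite_dimensional_vector_space s\<^sub>1 B\<^sub>1" "finite_dimensional_vector_space s\<^sub>3 B\<^sub>3"
    and "vector_space.dim s\<^sub>1 UNIV = vector_space.dim s\<^sub>3 UNIV"
  shows "composition_map s\<^sub>2 q\<^sub>2 s\<^sub>3 q\<^sub>3 s\<^sub>1 q\<^sub>1 m\<^sub>1"
  using q_derived[OF mult_surj[OF assms]] bilinear(2) by (simp add: composition_map_def)

end

theorem proposition2p3:
  fixes s\<^sub>1 :: "'f::field \<Rightarrow> 'u::ab_group_add \<Rightarrow> 'u" and q\<^sub>1 :: "'u \<Rightarrow> 'f" and B\<^sub>1 :: "'u set"
    and s\<^sub>2 :: "'f \<Rightarrow> 'v::ab_group_add \<Rightarrow> 'v" and q\<^sub>2 :: "'v \<Rightarrow> 'f" and B\<^sub>2 :: "'v set"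
    and s\<^sub>3 :: "'f \<Rightarrow> 'w::ab_group_add \<Rightarrow> 'w" and q\<^sub>3 :: "'w \<Rightarrow> 'f" and B\<^sub>3 :: "'w set"
    and m\<^sub>3 :: "'u \<Rightarrow> 'v \<Rightarrow> 'w" (infix \<open>\<star>\<^sub>3\<close> 70)
    and m\<^sub>1 :: "'v \<Rightarrow> 'w \<Rightarrow> 'u" (infix \<open>\<star>\<^sub>1\<close> 70)
    and m\<^sub>2 :: "'w \<Rightarrow> 'u \<Rightarrow> 'v" (infix \<open>\<star>\<^sub>2\<close> 70)
  defines "b\<^sub>1 \<equiv> polar_form q\<^sub>1" and "b\<^sub>2 \<equiv> polar_form q\<^sub>2" and "b\<^sub>3 \<equiv> polar_form q\<^sub>3"
  assumes "quadratic_space s\<^sub>1 q\<^sub>1" and "quadratic_space s\<^sub>2 q\<^sub>2" and "quadratic_space s\<^sub>3 q\<^sub>3"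
    and "finite_dimensional_vector_space s\<^sub>1 B\<^sub>1"
    and "finite_dimensional_vector_space s\<^sub>2 B\<^sub>2"
    and "finite_dimensional_vector_space s\<^sub>3 B\<^sub>3"
    and "nonsingular_form b\<^sub>1" and "nonsingular_form b\<^sub>2" and "nonsingular_form b\<^sub>3"
    and "vector_space.dim s\<^sub>1 UNIV = vector_space.dim s\<^sub>2 UNIV"
    and "vector_space.dim s\<^sub>2 UNIV = vector_space.dim s\<^sub>3 UNIV"
    and "composition_map s\<^sub>1 q\<^sub>1 s\<^sub>2 q\<^sub>2 s\<^sub>3 q\<^sub>3 m\<^sub>3"
    and "derived_maps s\<^sub>1 q\<^sub>1 s\<^sub>2 q\<^sub>2 s\<^sub>3 q\<^sub>3 m\<^sub>3 m\<^sub>1 m\<^sub>2"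
  shows "composition_map s\<^sub>2 q\<^sub>2 s\<^sub>3 q\<^sub>3 s\<^sub>1 q\<^sub>1 m\<^sub>1 \<and>
    composition_map s\<^sub>3 q\<^sub>3 s\<^sub>1 q\<^sub>1 s\<^sub>2 q\<^sub>2 m\<^sub>2 \<and>
    (\<forall>x\<^sub>1 y\<^sub>1 x\<^sub>2 y\<^sub>2 x\<^sub>3 y\<^sub>3.
      b\<^sub>3 (x\<^sub>1 \<star>\<^sub>3 x\<^sub>2) (x\<^sub>1 \<star>\<^sub>3 y\<^sub>2) = q\<^sub>1 x\<^sub>1 * b\<^sub>2 x\<^sub>2 y\<^sub>2 \<and>
      b\<^sub>3 (x\<^sub>1 \<star>\<^sub>3 x\<^sub>2) (y\<^sub>1 \<star>\<^sub>3 x\<^sub>2) = b\<^sub>1 x\<^sub>1 y\<^sub>1 * q\<^sub>2 x\<^sub>2 \<and>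
      b\<^sub>1 (x\<^sub>2 \<star>\<^sub>1 x\<^sub>3) (x\<^sub>2 \<star>\<^sub>1 y\<^sub>3) = q\<^sub>2 x\<^sub>2 * b\<^sub>3 x\<^sub>3 y\<^sub>3 \<and>
      b\<^sub>1 (x\<^sub>2 \<star>\<^sub>1 x\<^sub>3) (y\<^sub>2 \<star>\<^sub>1 x\<^sub>3) = b\<^sub>2 x\<^sub>2 y\<^sub>2 * q\<^sub>3 x\<^sub>3 \<and>
      b\<^sub>2 (x\<^sub>3 \<star>\<^sub>2 x\<^sub>1) (x\<^sub>3 \<star>\<^sub>2 y\<^sub>1) = q\<^sub>3 x\<^sub>3 * b\<^sub>1 x\<^sub>1 y\<^sub>1 \<and>
      b\<^sub>2 (x\<^sub>3 \<star>\<^sub>2 x\<^sub>1) (y\<^sub>3 \<star>\<^sub>2 x\<^sub>1) = b\<^sub>3 x\<^sub>3 y\<^sub>3 * q\<^sub>1 x\<^sub>1 \<and>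
      (x\<^sub>1 \<star>\<^sub>3 x\<^sub>2) \<star>\<^sub>2 x\<^sub>1 = s\<^sub>2 (q\<^sub>1 x\<^sub>1) x\<^sub>2 \<and>
      x\<^sub>2 \<star>\<^sub>1 (x\<^sub>1 \<star>\<^sub>3 x\<^sub>2) = s\<^sub>1 (q\<^sub>2 x\<^sub>2) x\<^sub>1 \<and>
      (x\<^sub>2 \<star>\<^sub>1 x\<^sub>3) \<star>\<^sub>3 x\<^sub>2 = s\<^sub>3 (q\<^sub>2 x\<^sub>2) x\<^sub>3 \<and>
      x\<^sub>3 \<star>\<^sub>2 (x\<^sub>2 \<star>\<^sub>1 x\<^sub>3) = s\<^sub>2 (q\<^sub>3 x\<^sub>3) x\<^sub>2 \<and>
      (x\<^sub>3 \<star>\<^sub>2 x\<^sub>1) \<star>\<^sub>1 x\<^sub>3 = s\<^sub>1 (q\<^sub>3 x\<^sub>3) x\<^sub>1 \<and>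
      x\<^sub>1 \<star>\<^sub>3 (x\<^sub>3 \<star>\<^sub>2 x\<^sub>1) = s\<^sub>3 (q\<^sub>1 x\<^sub>1) x\<^sub>3 \<and>
      (x\<^sub>1 \<star>\<^sub>3 x\<^sub>2) \<star>\<^sub>2 y\<^sub>1 + (y\<^sub>1 \<star>\<^sub>3 x\<^sub>2) \<star>\<^sub>2 x\<^sub>1 = s\<^sub>2 (b\<^sub>1 x\<^sub>1 y\<^sub>1) x\<^sub>2 \<and>
      x\<^sub>2 \<star>\<^sub>1 (x\<^sub>1 \<star>\<^sub>3 y\<^sub>2) + y\<^sub>2 \<star>\<^sub>1 (x\<^sub>1 \<star>\<^sub>3 x\<^sub>2) = s\<^sub>1 (b\<^sub>2 x\<^sub>2 y\<^sub>2) x\<^sub>1 \<and>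
      (x\<^sub>2 \<star>\<^sub>1 x\<^sub>3) \<star>\<^sub>3 y\<^sub>2 + (y\<^sub>2 \<star>\<^sub>1 x\<^sub>3) \<star>\<^sub>3 x\<^sub>2 = s\<^sub>3 (b\<^sub>2 x\<^sub>2 y\<^sub>2) x\<^sub>3 \<and>
      x\<^sub>3 \<star>\<^sub>2 (x\<^sub>2 \<star>\<^sub>1 y\<^sub>3) + y\<^sub>3 \<star>\<^sub>2 (x\<^sub>2 \<star>\<^sub>1 x\<^sub>3) = s\<^sub>2 (b\<^sub>3 x\<^sub>3 y\<^sub>3) x\<^sub>2 \<and>
      (x\<^sub>3 \<star>\<^sub>2 x\<^sub>1) \<star>\<^sub>1 y\<^sub>3 + (y\<^sub>3 \<star>\<^sub>2 x\<^sub>1) \<star>\<^sub>1 x\<^sub>3 = s\<^sub>1 (b\<^sub>3 x\<^sub>3 y\<^sub>3) x\<^sub>1 \<and>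
      x\<^sub>1 \<star>\<^sub>3 (x\<^sub>3 \<star>\<^sub>2 y\<^sub>1) + y\<^sub>1 \<star>\<^sub>3 (x\<^sub>3 \<star>\<^sub>2 x\<^sub>1) = s\<^sub>3 (b\<^sub>1 x\<^sub>1 y\<^sub>1) x\<^sub>3)"
proof -
  note bs = b\<^sub>1_def b\<^sub>2_def b\<^sub>3_def
  note hyps = assms(4-)[unfolded bs]
  interpret A: composition_triple s\<^sub>1 q\<^sub>1 s\<^sub>2 q\<^sub>2 s\<^sub>3 q\<^sub>3 m\<^sub>3 m\<^sub>1 m\<^sub>2
    using hyps by (simp add: composition_triple_def composition_triple_axioms_def)
  \<comment> \<open>In the flipped triple the first derived map is \<open>m\<^sub>2\<close> with its
    arguments reversed, so \<open>composition_derived\<close> yields \<open>c2\<close> after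
    flipping back.\<close>
  interpret A': composition_triple s\<^sub>2 q\<^sub>2 s\<^sub>1 q\<^sub>1 s\<^sub>3 q\<^sub>3
      "\<lambda>x\<^sub>2 x\<^sub>1. m\<^sub>3 x\<^sub>1 x\<^sub>2" "\<lambda>x\<^sub>1 x\<^sub>3. m\<^sub>2 x\<^sub>3 x\<^sub>1" "\<lambda>x\<^sub>3 x\<^sub>2. m\<^sub>1 x\<^sub>2 x\<^sub>3"
    using hyps composition_map_flip[OF A.comp] derived_maps_flip[OF A.derived]
    by (simp add: composition_triple_def composition_triple_axioms_def)
  have c1: "composition_map s\<^sub>2 q\<^sub>2 s\<^sub>3 q\<^sub>3 s\<^sub>1 q\<^sub>1 m\<^sub>1"
    using A.composition_derived hyps by simp
  have c2: "composition_map s\<^sub>3 q\<^sub>3 s\<^sub>1 q\<^sub>1 s\<^sub>2 q\<^sub>2 m\<^sub>2"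
    using composition_map_flip[OF A'.composition_derived] hyps by simp
  have d1: "derived_maps s\<^sub>2 q\<^sub>2 s\<^sub>3 q\<^sub>3 s\<^sub>1 q\<^sub>1 m\<^sub>1 m\<^sub>2 m\<^sub>3"
    using derived_maps_cycle[OF A.derived A.bilinear(1)] .
  have d2: "derived_maps s\<^sub>3 q\<^sub>3 s\<^sub>1 q\<^sub>1 s\<^sub>2 q\<^sub>2 m\<^sub>2 m\<^sub>3 m\<^sub>1"
    using derived_maps_cycle[OF d1 A.bilinear(2)] .
  \<comment> \<open>With \<open>c1\<close> and \<open>c2\<close> available, the rotated triples are
    composition triples too, and each inherits the identities proved for
    \<open>m\<^sub>3\<close>.\<close>
  interpret B: composition_triple s\<^sub>2 q\<^sub>2 s\<^sub>3 q\<^sub>3 s\<^sub>1 q\<^sub>1 m\<^sub>1 m\<^sub>2 m\<^sub>3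
    using hyps c1 d1 by (simp add: composition_triple_def composition_triple_axioms_def)
  interpret C: composition_triple s\<^sub>3 q\<^sub>3 s\<^sub>1 q\<^sub>1 s\<^sub>2 q\<^sub>2 m\<^sub>2 m\<^sub>3 m\<^sub>1
    using hyps c2 d2 by (simp add: composition_triple_def composition_triple_axioms_def)
  show ?thesis
    unfolding bs
    by (intro conjI allI c1 c2
        A.polar_mult_left A.polar_mult_right B.polar_mult_left B.polar_mult_right
        C.polar_mult_left C.polar_mult_right
        A.mult_cancel_left A.mult_cancel_right B.mult_cancel_left B.mult_cancel_right
        C.mult_cancel_left C.mult_cancel_right
        A.mult_cancel_left_polar A.mult_cancel_right_polar
        B.mult_cancel_left_polar B.mult_cancel_right_polar
        C.mult_cancel_left_polar C.mult_cancel_right_polar)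
qed

end
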